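(* Let $M$ be a finite $\mathscr R$-trivial monoid and $k$ a field. Fix for each $X\in\Lambda(M)$ an idempotent generator $e_X$. For $X,Y\in\Lambda(M)$ let $m_{X,Y}=|\{n\in\widetilde L_Y: e_Xn=n\}|$ and $c_{X,Y}=\dim_k\mathrm{Hom}_{kM}(P_X,P_Y)$. Then $c_{X,Y}=\sum_{Z\le X}m_{Z,Y}\,\mu(Z,X)$, where $\mu$ is the Möbius function of the lattice $\Lambda(M)$.
   Context: $M$ is $\mathscr R$-trivial if $mM=nM$ implies $m=n$. $\Lambda(M)$ is the set of ideals $MeM$, $e$ idempotent, ordered by inclusion (a lattice). $P_X$ is the projective cover of the one-dimensional simple module $S_X$ on which $m$ acts by $1$ if $X\subseteq Mm^\omega M$ ($m^\omega$ the idempotent power) and $0$ otherwise. Define $m\le_{\widetilde{\mathscr L}}n$ if for every idempotent $e$, $ne=n$ implies $me=m$; $\widetilde{\mathscr L}$ is the associated equivalence, and $\widetilde L_Y$ is the $\widetilde{\mathscr L}$-class of $e_Y$. *)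

theory Defs
  imports Main "HOL.Vector_Spaces" "HOL-Library.Function_Algebras"
begin

definition idem :: "'m::monoid_mult \<Rightarrow> bool" where
  "idem e \<longleftrightarrow> e * e = e"

definition omega :: "'m::monoid_mult \<Rightarrow> 'm" where
  "omega m = (THE e. idem e \<and> (\<exists>n\<ge>1. e = m ^ n))"

definition R_trivial :: "'m::monoid_mult itself \<Rightarrow> bool" where
  "R_trivial _ \<longleftrightarrow> (\<forall>m n::'m. (\<lambda>x. m * x) ` UNIV = (\<lambda>x. n * x) ` UNIV \<longrightarrow> m = n)"

definition two_sided :: "'m::monoid_mult \<Rightarrow> 'm set" where
  "two_sided e = {a * e * b | a b. True}"

definition Lambda :: "'m::monoid_mult set set" where
  "Lambda = {two_sided e | e. idem e}"

text \<open>character of the simple module S_X\<close>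
definition char_S :: "'m::monoid_mult set \<Rightarrow> 'm \<Rightarrow> 'k::field" where
  "char_S X m = (if X \<subseteq> two_sided (omega m) then 1 else 0)"

text \<open>kM is represented as functions M \<Rightarrow> k; left multiplication by a basis element m\<close>
definition lmul :: "'m::{monoid_mult,finite} \<Rightarrow> ('m \<Rightarrow> 'k::field) \<Rightarrow> ('m \<Rightarrow> 'k)" where
  "lmul m p = (\<lambda>z. \<Sum>y\<in>{y. m * y = z}. p y)"

definition kM_submodule :: "('m::{monoid_mult,finite} \<Rightarrow> 'k::field) set \<Rightarrow> bool" where
  "kM_submodule N \<longleftrightarrow> (\<lambda>_. 0) \<in> N
     \<and> (\<forall>p\<in>N. \<forall>q\<in>N. (\<lambda>z. p z + q z) \<in> N)
     \<and> (\<forall>c. \<forall>p\<in>N. (\<lambda>z. c * p z) \<in> N)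
     \<and> (\<forall>m. \<forall>p\<in>N. lmul m p \<in> N)"

text \<open>P is a projective cover of S_X, realised as a direct summand of the regular module kM
  (a projective module) together with an essential epimorphism onto S_X.\<close>
definition proj_cover :: "'m::{monoid_mult,finite} set \<Rightarrow> ('m \<Rightarrow> 'k::field) set \<Rightarrow> bool" where
  "proj_cover X P \<longleftrightarrow> kM_submodule P
     \<and> (\<exists>Q. kM_submodule Q \<and> P \<inter> Q = {\<lambda>_. 0}
            \<and> (\<forall>a. \<exists>p\<in>P. \<exists>q\<in>Q. a = (\<lambda>z. p z + q z)))
     \<and> (\<exists>\<pi>::('m \<Rightarrow> 'k) \<Rightarrow> 'k.
          (\<forall>p\<in>P. \<forall>q\<in>P. \<pi> (\<lambda>z. p z + q z) = \<pi> p + \<pi> q)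
        \<and> (\<forall>c. \<forall>p\<in>P. \<pi> (\<lambda>z. c * p z) = c * \<pi> p)
        \<and> (\<forall>m. \<forall>p\<in>P. \<pi> (lmul m p) = char_S X m * \<pi> p)
        \<and> (\<forall>c. \<exists>p\<in>P. \<pi> p = c)
        \<and> (\<forall>N. kM_submodule N \<and> N \<subseteq> P
               \<and> (\<forall>p\<in>P. \<exists>n\<in>N. \<exists>q\<in>P. \<pi> q = 0 \<and> p = (\<lambda>z. n z + q z))
               \<longrightarrow> N = P))"

definition kM_Hom :: "('m::{monoid_mult,finite} \<Rightarrow> 'k::field) set \<Rightarrow> ('m \<Rightarrow> 'k) set
    \<Rightarrow> (('m \<Rightarrow> 'k) \<Rightarrow> ('m \<Rightarrow> 'k)) set" where
  "kM_Hom P Q = {\<phi>. (\<forall>p\<in>P. \<phi> p \<in> Q) \<and> (\<forall>p. p \<notin> P \<longrightarrow> \<phi> p = (\<lambda>_. 0))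
     \<and> (\<forall>p\<in>P. \<forall>q\<in>P. \<phi> (\<lambda>z. p z + q z) = (\<lambda>z. \<phi> p z + \<phi> q z))
     \<and> (\<forall>c. \<forall>p\<in>P. \<phi> (\<lambda>z. c * p z) = (\<lambda>z. c * \<phi> p z))
     \<and> (\<forall>m. \<forall>p\<in>P. \<phi> (lmul m p) = lmul m (\<phi> p))}"

definition hom_dim :: "('m::{monoid_mult,finite} \<Rightarrow> 'k::field) set \<Rightarrow> ('m \<Rightarrow> 'k) set \<Rightarrow> nat" where
  "hom_dim P Q = vector_space.dim (\<lambda>(c::'k) \<phi>. (\<lambda>p z. c * \<phi> p z)) (kM_Hom P Q)"

definition Ltilde_le :: "'m::monoid_mult \<Rightarrow> 'm \<Rightarrow> bool" where
  "Ltilde_le m n \<longleftrightarrow> (\<forall>e. idem e \<and> n * e = n \<longrightarrow> m * e = m)"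

definition Ltilde_class :: "'m::monoid_mult \<Rightarrow> 'm set" where
  "Ltilde_class e = {n. Ltilde_le n e \<and> Ltilde_le e n}"

definition mcount :: "('m::monoid_mult set \<Rightarrow> 'm) \<Rightarrow> 'm set \<Rightarrow> 'm set \<Rightarrow> nat" where
  "mcount eg X Y = card {n \<in> Ltilde_class (eg Y). eg X * n = n}"

definition mobius :: "'a set \<Rightarrow> ('a \<Rightarrow> 'a \<Rightarrow> bool) \<Rightarrow> 'a \<Rightarrow> 'a \<Rightarrow> int" where
  "mobius L le = (THE f. (\<forall>x y. \<not> (x \<in> L \<and> y \<in> L \<and> le x y) \<longrightarrow> f x y = 0)
      \<and> (\<forall>x\<in>L. \<forall>y\<in>L. le x y \<longrightarrow>
           (\<Sum>z\<in>{z\<in>L. le x z \<and> le z y}. f x z) = (if x = y then 1 else 0)))"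

end

(* The regular right module is triangular in the basis M: if nM is maximal among the right ideals
   generated by elements of a right ideal U, then u x = n with u in U forces u = n. The diagonal
   entries are the characters m |-> [nm = n], and the one at n is that of S_Y exactly when n lies in
   the Ltilde-class of e_Y. On the left there is a dual filtration of every submodule V: if mV is
   nonzero with mM minimal, then m(xv) = [mx = m] mv on V, so V has a one-dimensional quotient with
   character x |-> [mx = m].

   A projective cover P_X is kM epsilon_X with epsilon_X the idempotent component of 1, and
   chi_Z(epsilon_X) = [Z = X]; hence Hom(P_X, P_Y) = epsilon_X P_Y. The rank of an idempotent acting
   triangularly is the number of its nonzero diagonal entries, in any characteristic. Therefore
   dim epsilon_X P_Y is the multiplicity of S_X in P_Y, and dim e_W P_Y is the sum of the
   multiplicities of the S_Z with Z <= W; on the other hand e_W P_Y = (e_W kM) epsilon_Y has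
   dimension m_{W,Y} by the right triangularity. Moebius inversion finishes. *)
theory Submission
  imports Defs
begin

section \<open>Moebius inversion on finite posets\<close>

text \<open>The condition inside the definite description of \<open>mobius\<close>: the convolution
  of \<open>f\<close> with zeta is the identity of the incidence algebra. As a predicate it can also
  be used for the reversed order.\<close>

definition incidence_inverse :: "'a set \<Rightarrow> ('a \<Rightarrow> 'a \<Rightarrow> bool) \<Rightarrow> ('a \<Rightarrow> 'a \<Rightarrow> int) \<Rightarrow> bool" where
  "incidence_inverse L le f \<longleftrightarrow> (\<forall>x y. \<not> (x \<in> L \<and> y \<in> L \<and> le x y) \<longrightarrow> f x y = 0)
      \<and> (\<forall>x\<in>L. \<forall>y\<in>L. le x y \<longrightarrow>
           (\<Sum>z\<in>{z\<in>L. le x z \<and> le z y}. f x z) = (if x = y then 1 else 0))"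

text \<open>Induction removing a maximal element \<open>t\<close>: intervals with another top avoid
  \<open>t\<close>, so old values survive and only the column of \<open>t\<close> has to be solved
  for.\<close>

lemma incidence_inverse_exists:
  assumes "finite L"
    and refl: "\<And>x. le x x"
    and antisym: "\<And>x y. le x y \<Longrightarrow> le y x \<Longrightarrow> x = y"
    and trans: "\<And>x y z. le x y \<Longrightarrow> le y z \<Longrightarrow> le x z"
  shows "\<exists>f. incidence_inverse L le f"
  using assms(1)
proof (induction L rule: finite_psubset_induct)
  case (psubset L)
  show ?case
  proof (cases "L = {}")
    case True
    then show ?thesis by (auto simp: incidence_inverse_def)
  next
    case False
    \<comment> \<open>An element with the most elements below it is maximal: anything strictly above
      it would have a strictly larger down-set.\<close>
    define s where "s = (\<lambda>x. card {z\<in>L. le z x})"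
    obtain t where t: "t \<in> L" and smax: "\<And>x. x \<in> L \<Longrightarrow> s x \<le> s t"
      using finite_has_maximal[of "s ` L"] psubset.hyps False
      by (metis (no_types, lifting) imageE image_eqI finite_imageI image_is_empty linorder_linear)
    have max: "x = t" if "x \<in> L" "le t x" for x
    proof (rule ccontr)
      assume "x \<noteq> t"
      then have "{z\<in>L. le z t} \<subset> {z\<in>L. le z x}"
        using that refl antisym trans by blast
      then have "s t < s x"
        unfolding s_def using psubset.hyps by (intro psubset_card_mono) auto
      then show False using smax[OF that(1)] by simp
    qed
    obtain f where f: "incidence_inverse (L - {t}) le f"
      using psubset.IH[of "L - {t}"] t by auto
    \<comment> \<open>In column \<open>t\<close> the entry at \<open>x\<close> below
      \<open>t\<close> is minus the sum of the earlier values, which makes the sum over the interval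
      vanish; the diagonal entry is 1.\<close>
    define g where "g = (\<lambda>x y. if y \<noteq> t then f x y else if x = t then 1
        else if x \<in> L \<and> le x t then - (\<Sum>z\<in>{z\<in>L-{t}. le x z}. if le z t then f x z else 0) else 0)"
    have "incidence_inverse L le g"
      unfolding incidence_inverse_def
    proof (intro conjI allI ballI impI)
      fix x y assume "\<not> (x \<in> L \<and> y \<in> L \<and> le x y)"
      then show "g x y = 0"
        using f t refl unfolding incidence_inverse_def g_def by auto
    next
      fix x y assume xy: "x \<in> L" "y \<in> L" "le x y"
      show "(\<Sum>z\<in>{z\<in>L. le x z \<and> le z y}. g x z) = (if x = y then 1 else 0)"
      proof (cases "y = t")
        case False
        then have x: "x \<noteq> t" using max xy by auto
        have "{z\<in>L. le x z \<and> le z y} = {z\<in>L-{t}. le x z \<and> le z y}"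
          using False max xy by auto
        moreover have "(\<Sum>z\<in>{z\<in>L-{t}. le x z \<and> le z y}. g x z)
            = (\<Sum>z\<in>{z\<in>L-{t}. le x z \<and> le z y}. f x z)"
          by (rule sum.cong) (auto simp: g_def)
        ultimately show ?thesis
          using f x False xy unfolding incidence_inverse_def by auto
      next
        case True
        show ?thesis
        proof (cases "x = t")
          case True
          then have "{z\<in>L. le x z \<and> le z y} = {t}" using \<open>y = t\<close> t refl antisym by auto
          then show ?thesis using True \<open>y = t\<close> by (simp add: g_def)
        next
          case False
          have "{z\<in>L. le x z \<and> le z y} = insert t {z\<in>L-{t}. le x z \<and> le z t}"
            using True xy refl by auto
          then have "(\<Sum>z\<in>{z\<in>L. le x z \<and> le z y}. g x z)
              = g x t + (\<Sum>z\<in>{z\<in>L-{t}. le x z \<and> le z t}. g x z)"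
            using psubset.hyps by simp
          also have "(\<Sum>z\<in>{z\<in>L-{t}. le x z \<and> le z t}. g x z)
              = (\<Sum>z\<in>{z\<in>L-{t}. le x z}. if le z t then f x z else 0)"
            using psubset.hyps by (intro sum.mono_neutral_cong_left) (auto simp: g_def)
          finally show ?thesis using False True xy by (simp add: g_def)
        qed
      qed
    qed
    then show ?thesis by blast
  qed
qed

text \<open>Turns the defining recursion of \<open>mobius\<close>, summed over the second argument, into the one summed
  over the first: a right inverse of zeta in the incidence algebra is also a left inverse.\<close>
lemma mobius_dual_incidence_inverse:
  assumes "finite L"
    and refl: "\<And>x. le x x"
    and antisym: "\<And>x y. le x y \<Longrightarrow> le y x \<Longrightarrow> x = y"
    and trans: "\<And>x y z. le x y \<Longrightarrow> le y z \<Longrightarrow> le x z"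
  shows "incidence_inverse L (\<lambda>x y. le y x) (\<lambda>x y. mobius L le y x)"
proof -
  obtain f where f: "incidence_inverse L le f"
    using incidence_inverse_exists[of L le] assms by blast
  have "\<exists>g. incidence_inverse L (\<lambda>x y. le y x) g"
    by (rule incidence_inverse_exists) (use assms in blast)+
  then obtain g where g: "incidence_inverse L (\<lambda>x y. le y x) g" by blast
  have unique: "h x y = g y x" if h: "incidence_inverse L le h" for h x y
  proof (cases "x \<in> L \<and> y \<in> L \<and> le x y")
    case False
    then have "h x y = 0" "g y x = 0"
      using h g unfolding incidence_inverse_def by blast+
    then show ?thesis by simp
  next
    case True
    \<comment> \<open>The sum of \<open>h x u * g y z\<close> over all chains x \<le> u \<le> z
      \<le> y is evaluated twice: summing over \<open>u\<close> first leaves only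
      \<open>z = x\<close>, summing over \<open>z\<close> first leaves only
      \<open>u = y\<close>.\<close>
    let ?P = "\<lambda>u z. le x u \<and> le u z \<and> le z y"
    have L: "(\<Sum>u\<in>L. if ?P u z then h x u else 0) = (if z = x then 1 else 0)" if z: "z \<in> L" for z
    proof (cases "le x z \<and> le z y")
      case True
      have "(\<Sum>u\<in>L. if ?P u z then h x u else 0) = (\<Sum>u\<in>{u\<in>L. le x u \<and> le u z}. h x u)"
        using assms(1) True by (intro sum.mono_neutral_cong_right) auto
      also have "\<dots> = (if z = x then 1 else 0)"
        using h True z \<open>x \<in> L \<and> y \<in> L \<and> le x y\<close> unfolding incidence_inverse_def by auto
      finally show ?thesis .
    next
      case False
      then have "?P u z \<longleftrightarrow> False" "z \<noteq> x" for u
        using trans refl \<open>x \<in> L \<and> y \<in> L \<and> le x y\<close> by blast+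
      then show ?thesis by (simp only: if_False sum.neutral_const)
    qed
    have R: "(\<Sum>z\<in>L. if ?P u z then g y z else 0) = (if u = y then 1 else 0)" if u: "u \<in> L" for u
    proof (cases "le x u \<and> le u y")
      case True
      have "(\<Sum>z\<in>L. if ?P u z then g y z else 0) = (\<Sum>z\<in>{z\<in>L. le z y \<and> le u z}. g y z)"
        using assms(1) True by (intro sum.mono_neutral_cong_right) auto
      also have "\<dots> = (if u = y then 1 else 0)"
        using g True u \<open>x \<in> L \<and> y \<in> L \<and> le x y\<close> unfolding incidence_inverse_def by auto
      finally show ?thesis .
    next
      case False
      then have "?P u z \<longleftrightarrow> False" "u \<noteq> y" for z
        using trans refl \<open>x \<in> L \<and> y \<in> L \<and> le x y\<close> by blast+
      then show ?thesis by (simp only: if_False sum.neutral_const)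
    qed
    have "g y x = (\<Sum>z\<in>L. if z = x then g y z else 0)"
      using assms(1) True by simp
    also have "\<dots> = (\<Sum>z\<in>L. (\<Sum>u\<in>L. if ?P u z then h x u else 0) * g y z)"
      using L by (intro sum.cong) auto
    also have "\<dots> = (\<Sum>z\<in>L. \<Sum>u\<in>L. if ?P u z then h x u * g y z else 0)"
      by (simp add: sum_distrib_right if_distrib if_distribR cong: if_cong)
    also have "\<dots> = (\<Sum>u\<in>L. \<Sum>z\<in>L. if ?P u z then h x u * g y z else 0)"
      by (rule sum.swap)
    also have "\<dots> = (\<Sum>u\<in>L. h x u * (\<Sum>z\<in>L. if ?P u z then g y z else 0))"
      by (simp add: sum_distrib_left if_distrib cong: if_cong)
    also have "\<dots> = (\<Sum>u\<in>L. if u = y then h x u else 0)"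
      using R by (intro sum.cong) auto
    also have "\<dots> = h x y" using assms(1) True by simp
    finally show ?thesis by simp
  qed
  have mob: "mobius L le = (THE f. incidence_inverse L le f)"
    by (simp add: mobius_def incidence_inverse_def)
  \<comment> \<open>Every solution is the transpose of the same \<open>g\<close>, so the definite
    description in \<open>mobius\<close> denotes one.\<close>
  have "\<exists>!f. incidence_inverse L le f"
    using f unique by (metis ext)
  then have m: "incidence_inverse L le (mobius L le)"
    unfolding mob by (rule theI')
  show ?thesis
    unfolding unique[OF m] using g by simp
qed

text \<open>After swapping the sums, the coefficient of \<open>c w\<close> is the sum of the Moebius
  values over the interval from \<open>w\<close> to \<open>x\<close> in the first argument, which
  the dual recursion evaluates.\<close>

lemma mobius_inversion:
  fixes c :: "'a \<Rightarrow> int"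
  assumes "finite L"
    and "\<And>x. le x x"
    and "\<And>x y. le x y \<Longrightarrow> le y x \<Longrightarrow> x = y"
    and trans: "\<And>x y z. le x y \<Longrightarrow> le y z \<Longrightarrow> le x z"
    and x: "x \<in> L"
  shows "(\<Sum>z\<in>{z\<in>L. le z x}. (\<Sum>w\<in>{w\<in>L. le w z}. c w) * mobius L le z x) = c x"
proof -
  have inv: "incidence_inverse L (\<lambda>x y. le y x) (\<lambda>x y. mobius L le y x)"
    using assms by (intro mobius_dual_incidence_inverse) blast+
  have "(\<Sum>z\<in>{z\<in>L. le z x}. (\<Sum>w\<in>{w\<in>L. le w z}. c w) * mobius L le z x)
      = (\<Sum>z\<in>{z\<in>L. le z x}. \<Sum>w\<in>L. if le w z then c w * mobius L le z x else 0)"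
    using assms(1) by (intro sum.cong refl)
      (auto simp: sum_distrib_right sum.inter_filter intro!: sum.cong)
  also have "\<dots> = (\<Sum>w\<in>L. \<Sum>z\<in>{z\<in>L. le z x}. if le w z then c w * mobius L le z x else 0)"
    by (rule sum.swap)
  also have "\<dots> = (\<Sum>w\<in>L. c w * (\<Sum>z\<in>{z\<in>L. le z x \<and> le w z}. mobius L le z x))"
    using assms(1) by (intro sum.cong refl)
      (auto simp: sum_distrib_left intro!: sum.mono_neutral_cong_right split: if_splits)
  also have "\<dots> = (\<Sum>w\<in>L. if w = x then c w else 0)"
  proof (intro sum.cong refl)
    fix w assume w: "w \<in> L"
    show "c w * (\<Sum>z\<in>{z\<in>L. le z x \<and> le w z}. mobius L le z x) = (if w = x then c w else 0)"
    proof (cases "le w x")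
      case True
      then show ?thesis using inv w x unfolding incidence_inverse_def by auto
    next
      case False
      then have "{z\<in>L. le z x \<and> le w z} = {}" using trans by blast
      moreover have "w = x \<longleftrightarrow> False" using False assms(2) by blast
      ultimately show ?thesis by (simp only: if_False sum.empty mult_zero_right)
    qed
  qed
  also have "\<dots> = c x" using assms(1) x by simp
  finally show ?thesis .
qed

section \<open>Characters of R-trivial monoids\<close>

text \<open>From m = (mx)y the elements \<open>m\<close> and \<open>m * x\<close> generate the same
  right ideal.\<close>

lemma R_trivialD:
  fixes m x y :: "'m::monoid_mult"
  assumes "R_trivial TYPE('m)" "m * x * y = m"
  shows "m * x = m"
proof -
  have "range (\<lambda>z. m * x * z) = range (\<lambda>z. m * z)"
  proof (intro equalityI subsetI)
    fix u assume "u \<in> range (\<lambda>z. m * z)"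
    then obtain z where "u = m * z" by blast
    then have "u = m * x * (y * z)" using assms(2) by (metis mult.assoc)
    then show "u \<in> range (\<lambda>z. m * x * z)" by blast
  qed (auto simp: mult.assoc)
  then show ?thesis using assms(1) unfolding R_trivial_def by metis
qed

text \<open>This makes m |-> [nm = n] multiplicative, hence a character of the monoid for every
  \<open>n\<close>.\<close>

lemma R_trivial_fix_mult:
  fixes n a b :: "'m::monoid_mult"
  assumes "R_trivial TYPE('m)"
  shows "n * (a * b) = n \<longleftrightarrow> n * a = n \<and> n * b = n"
  using R_trivialD[OF assms, of n a b] by (metis mult.assoc)

lemma R_trivial_fix_power:
  fixes n m :: "'m::monoid_mult"
  assumes "R_trivial TYPE('m)" "k \<ge> 1"
  shows "n * m ^ k = n \<longleftrightarrow> n * m = n"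
  using assms(2)
proof (induction k rule: nat_induct_at_least)
  case (Suc k)
  then show ?case using R_trivial_fix_mult[OF assms(1), of n m "m ^ k"] by auto
qed simp

text \<open>Two powers of \<open>m\<close> coincide by pigeonhole, and R-triviality then makes the
  powers stabilise, so an idempotent power exists. Two idempotent powers agree because each is a
  power of the other.\<close>

lemma omega_eq:
  fixes m :: "'m::{monoid_mult,finite}"
  assumes "R_trivial TYPE('m)"
  shows "idem (omega m) \<and> (\<exists>k\<ge>1. omega m = m ^ k)"
proof -
  have "\<not> inj (\<lambda>k::nat. m ^ k)"
    using finite_imageD infinite_UNIV_nat by (metis finite)
  then obtain i j where ij: "i < j" "m ^ i = m ^ j"
    unfolding inj_def by (metis nat_neq_iff)
  \<comment> \<open>The exponent \<open>i\<close> may be 0, whereas \<open>omega\<close> asks for a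
    positive one.\<close>
  define k where "k = Suc i"
  have "m ^ i * m ^ (j - i) = m ^ i"
    using ij by (metis less_imp_le le_add_diff_inverse power_add)
  then have "m ^ i * m = m ^ i"
    using R_trivial_fix_power[OF assms, of "j - i" "m ^ i" m] ij(1) by simp
  then have "m ^ k * m = m ^ k" unfolding k_def by (simp add: power_commutes)
  then have "m ^ k * m ^ k = m ^ k"
    using R_trivial_fix_power[OF assms, of k "m ^ k" m] unfolding k_def by simp
  then have k: "idem (m ^ k)" "k \<ge> 1" by (auto simp: idem_def k_def)
  have idem_power: "e ^ j = e" if "idem e" "j \<ge> 1" for e :: 'm and j
    using that(2,1) by (induction j rule: nat_induct_at_least) (auto simp: idem_def)
  have "\<exists>!e. idem e \<and> (\<exists>n\<ge>1. e = m ^ n)"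
  proof (rule ex1I)
    show "idem (m ^ k) \<and> (\<exists>n\<ge>1. m ^ k = m ^ n)" using k by blast
  next
    fix e assume e: "idem e \<and> (\<exists>n\<ge>1. e = m ^ n)"
    then obtain n where n: "n \<ge> 1" "e = m ^ n" by blast
    have "e = e ^ k" using e k idem_power by simp
    also have "\<dots> = (m ^ k) ^ n" using n by (metis power_mult mult.commute)
    also have "\<dots> = m ^ k" using k n idem_power by simp
    finally show "e = m ^ k" .
  qed
  then show ?thesis unfolding omega_def by (rule theI')
qed

lemma fix_omega_iff:
  fixes n m :: "'m::{monoid_mult,finite}"
  assumes "R_trivial TYPE('m)"
  shows "n * omega m = n \<longleftrightarrow> n * m = n"
  using omega_eq[OF assms, of m] R_trivial_fix_power[OF assms] by metis

text \<open>If e = afb, then \<open>e\<close> fixes the product a(fb) on the right, hence each of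
  its factors, in particular \<open>f\<close>. Inclusion in the lattice thus becomes a fixing
  condition.\<close>

lemma two_sided_subset_iff:
  fixes e f :: "'m::monoid_mult"
  assumes R: "R_trivial TYPE('m)" and "idem e" "idem f"
  shows "two_sided e \<subseteq> two_sided f \<longleftrightarrow> e * f = e"
proof
  assume "two_sided e \<subseteq> two_sided f"
  moreover have "e \<in> two_sided e"
    unfolding two_sided_def by (metis (mono_tags, lifting) mem_Collect_eq mult_1_left mult_1_right)
  ultimately obtain a b where "e = a * f * b" unfolding two_sided_def by blast
  then have "e * (a * (f * b)) = e" using \<open>idem e\<close> by (simp add: idem_def mult.assoc)
  then show "e * f = e" using R_trivial_fix_mult[OF R] by blast
next
  assume ef: "e * f = e"
  show "two_sided e \<subseteq> two_sided f"
  proof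
    fix x assume "x \<in> two_sided e"
    then obtain a b where "x = a * e * b" unfolding two_sided_def by blast
    then have "x = (a * e) * f * b" using ef by (simp add: mult.assoc)
    then show "x \<in> two_sided f" unfolding two_sided_def by blast
  qed
qed

text \<open>Identifies the characters of the simple modules with the fixing characters of
  idempotents, since an element is fixed by \<open>m\<close> exactly when it is fixed by
  \<open>omega m\<close>.\<close>

lemma char_S_eq:
  fixes e m :: "'m::{monoid_mult,finite}"
  assumes "R_trivial TYPE('m)" "idem e"
  shows "char_S (two_sided e) m = (if e * m = e then 1 else 0)"
  using two_sided_subset_iff[OF assms(1,2), of "omega m"] omega_eq[OF assms(1), of m]
    fix_omega_iff[OF assms(1), of e m]
  by (simp add: char_S_def)

text \<open>The witness is an idempotent generating the least right ideal among those generated by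
  elements fixing \<open>n\<close> on the right.\<close>
lemma fix_character_idem:
  fixes n :: "'m::{monoid_mult,finite}"
  assumes R: "R_trivial TYPE('m)"
  obtains e where "idem e" "\<And>m. e * m = e \<longleftrightarrow> n * m = n"
proof -
  define r where "r = (\<lambda>m::'m. card (range (\<lambda>x. m * x)))"
  obtain e where e: "n * e = n" and min: "\<And>f. n * f = n \<Longrightarrow> r e \<le> r f"
    using ex_has_least_nat[of "\<lambda>m. n * m = n" 1 r] by auto
  \<comment> \<open>The product \<open>e * f\<close> fixes \<open>n\<close> as well, so minimality
    leaves no room between its right ideal and that of \<open>e\<close>.\<close>
  have ef: "e * f = e" if "n * f = n" for f
  proof -
    have "n * (e * f) = n" using e that by (simp add: mult.assoc[symmetric])
    then have "r e \<le> r (e * f)" by (rule min)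
    moreover have "range (\<lambda>x. e * f * x) \<subseteq> range (\<lambda>x. e * x)"
      by (auto simp: mult.assoc)
    ultimately have "range (\<lambda>x. e * f * x) = range (\<lambda>x. e * x)"
      unfolding r_def by (intro card_seteq) auto
    then show ?thesis using R unfolding R_trivial_def by blast
  qed
  show ?thesis
  proof
    show "idem e" using ef[OF e] by (simp add: idem_def)
    show "e * m = e \<longleftrightarrow> n * m = n" for m
      using ef e by (metis mult.assoc)
  qed
qed

lemma fix_character_eq_char_S:
  fixes n :: "'m::{monoid_mult,finite}"
  assumes R: "R_trivial TYPE('m)"
  obtains Z where "Z \<in> Lambda" "(char_S Z :: 'm \<Rightarrow> 'k::field) = (\<lambda>m. if n * m = n then 1 else 0)"
proof -
  obtain e where e: "idem e" "\<And>m. e * m = e \<longleftrightarrow> n * m = n"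
    using fix_character_idem[OF R, of n] by blast
  show ?thesis
  proof
    show "two_sided e \<in> Lambda" using e unfolding Lambda_def by blast
    show "char_S (two_sided e) = (\<lambda>m. if n * m = n then 1 else 0)"
      using char_S_eq[OF R e(1)] e(2) by fastforce
  qed
qed

text \<open>As 0 and 1 differ in every field, equal characters mean that \<open>e\<close> and
  \<open>f\<close> are fixed by the same elements. Each fixes itself, so each fixes the other, and
  the ideals include one another.\<close>

lemma char_S_inj:
  fixes X Z :: "'m::{monoid_mult,finite} set"
  assumes R: "R_trivial TYPE('m)" and "X \<in> Lambda" "Z \<in> Lambda"
    and eq: "(char_S X :: 'm \<Rightarrow> 'k::field) = char_S Z"
  shows "X = Z"
proof -
  obtain e f where e: "idem e" "X = two_sided e" and f: "idem f" "Z = two_sided f"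
    using assms unfolding Lambda_def by blast
  have iff: "e * m = e \<longleftrightarrow> f * m = f" for m
    using fun_cong[OF eq, of m] unfolding e f char_S_eq[OF R e(1)] char_S_eq[OF R f(1)]
    by (auto split: if_splits)
  have "e * f = e" "f * e = f"
    using iff e(1) f(1) by (auto simp: idem_def)
  then show ?thesis
    using two_sided_subset_iff[OF R] e f by blast
qed

text \<open>The relation tests only idempotents, but \<open>m\<close> fixes \<open>n\<close> exactly
  when the idempotent \<open>omega m\<close> does, so it compares the full fixing
  characters.\<close>

lemma Ltilde_class_iff:
  fixes n e :: "'m::{monoid_mult,finite}"
  assumes R: "R_trivial TYPE('m)" and "idem e"
  shows "n \<in> Ltilde_class e \<longleftrightarrow>
    (char_S (two_sided e) :: 'm \<Rightarrow> 'k::field) = (\<lambda>m. if n * m = n then 1 else 0)"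
proof -
  have "n \<in> Ltilde_class e \<longleftrightarrow> (\<forall>f. idem f \<longrightarrow> (n * f = n \<longleftrightarrow> e * f = e))"
    unfolding Ltilde_class_def Ltilde_le_def by blast
  also have "\<dots> \<longleftrightarrow> (\<forall>m. n * m = n \<longleftrightarrow> e * m = e)"
    using fix_omega_iff[OF R] omega_eq[OF R] by metis
  also have "\<dots> \<longleftrightarrow> (char_S (two_sided e) :: 'm \<Rightarrow> 'k) = (\<lambda>m. if n * m = n then 1 else 0)"
    unfolding fun_eq_iff char_S_eq[OF R assms(2)] by auto
  finally show ?thesis .
qed

lemma char_S_mult:
  fixes a b :: "'m::{monoid_mult,finite}"
  assumes R: "R_trivial TYPE('m)" and "Z \<in> Lambda"
  shows "char_S Z (a * b) = char_S Z a * char_S Z b"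
proof -
  obtain e where e: "idem e" "Z = two_sided e"
    using assms unfolding Lambda_def by blast
  show ?thesis
    unfolding e char_S_eq[OF R e(1)] using R_trivial_fix_mult[OF R, of e a b] by simp
qed

section \<open>The monoid algebra\<close>

definition fscale :: "'k::field \<Rightarrow> ('m \<Rightarrow> 'k) \<Rightarrow> 'm \<Rightarrow> 'k" where
  "fscale c p = (\<lambda>z. c * p z)"

text \<open>The monoid element \<open>x\<close> as a basis vector of kM.\<close>

definition delta :: "'m \<Rightarrow> 'm \<Rightarrow> 'k::field" where
  "delta x = (\<lambda>z. if z = x then 1 else 0)"

lemma sum_fun_apply: "(\<Sum>x\<in>A. g x) z = (\<Sum>x\<in>A. g x z)"
  by (induction A rule: infinite_finite_induct) auto

lemma sum_delta_mult:
  fixes g :: "'m::finite \<Rightarrow> 'k::field"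
  shows "(\<Sum>x\<in>UNIV. delta m x * g x) = g m"
proof -
  have "(\<Sum>x\<in>UNIV. delta m x * g x) = (\<Sum>x\<in>UNIV. if x = m then g x else 0)"
    by (rule sum.cong) (auto simp: delta_def)
  then show ?thesis by simp
qed

lemma fun_eq_sum_delta:
  fixes p :: "'m::finite \<Rightarrow> 'k::field"
  shows "p = (\<Sum>x\<in>UNIV. fscale (p x) (delta x))"
proof
  fix z
  have "(\<Sum>x\<in>UNIV. fscale (p x) (delta x)) z = (\<Sum>x\<in>UNIV. if x = z then p x else 0)"
    unfolding sum_fun_apply by (rule sum.cong) (auto simp: fscale_def delta_def)
  then show "p z = (\<Sum>x\<in>UNIV. fscale (p x) (delta x)) z" by simp
qed

interpretation fs: vector_space "fscale :: 'k::field \<Rightarrow> ('m \<Rightarrow> 'k) \<Rightarrow> 'm \<Rightarrow> 'k"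
  by unfold_locales (auto simp: fscale_def fun_eq_iff algebra_simps)

lemma inj_delta: "inj (delta :: 'm \<Rightarrow> 'm \<Rightarrow> 'k::field)"
  by (rule injI) (metis delta_def zero_neq_one)

interpretation fs: finite_dimensional_vector_space
  "fscale :: 'k::field \<Rightarrow> ('m::finite \<Rightarrow> 'k) \<Rightarrow> 'm \<Rightarrow> 'k" "range delta"
proof
  show "fs.independent (range (delta :: 'm \<Rightarrow> 'm \<Rightarrow> 'k))"
  proof (rule fs.independent_if_scalars_zero)
    fix f :: "('m \<Rightarrow> 'k) \<Rightarrow> 'k" and q
    assume *: "(\<Sum>x\<in>range delta. fscale (f x) x) = 0" and "q \<in> range (delta :: 'm \<Rightarrow> 'm \<Rightarrow> 'k)"
    then obtain x where q: "q = delta x" by blast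
    have "(\<Sum>x\<in>range delta. fscale (f x) x) = (\<Sum>x\<in>UNIV. fscale (f (delta x)) (delta x))"
      by (subst sum.reindex) (auto simp: inj_delta)
    also have "\<dots> = (\<lambda>x. f (delta x))" using fun_eq_sum_delta[of "\<lambda>x. f (delta x)"] by simp
    finally show "f q = 0" using * q by (metis zero_fun_apply)
  qed simp
  show "fs.span (range (delta :: 'm \<Rightarrow> 'm \<Rightarrow> 'k)) = UNIV"
  proof (intro equalityI subsetI UNIV_I)
    fix p :: "'m \<Rightarrow> 'k"
    show "p \<in> fs.span (range delta)"
      by (subst fun_eq_sum_delta) (intro fs.span_sum fs.span_scale fs.span_base rangeI)
  qed
qed simp

section \<open>The product of the monoid algebra\<close>

definition conv :: "('m::{monoid_mult,finite} \<Rightarrow> 'k::field) \<Rightarrow> ('m \<Rightarrow> 'k) \<Rightarrow> 'm \<Rightarrow> 'k" where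
  "conv p q = (\<lambda>z. \<Sum>x\<in>UNIV. \<Sum>y\<in>UNIV. if x * y = z then p x * q y else 0)"

definition lin_ext :: "('m::finite \<Rightarrow> 'k::field) \<Rightarrow> ('m \<Rightarrow> 'k) \<Rightarrow> 'k" where
  "lin_ext h p = (\<Sum>x\<in>UNIV. p x * h x)"

lemma lin_ext_add: "lin_ext h (p + q) = lin_ext h p + lin_ext h q"
  by (simp add: lin_ext_def algebra_simps sum.distrib)

lemma lin_ext_diff: "lin_ext h (p - q) = lin_ext h p - lin_ext h q"
  by (simp add: lin_ext_def algebra_simps sum_subtractf)

lemma lin_ext_scale: "lin_ext h (fscale c p) = c * lin_ext h p"
  by (simp add: lin_ext_def fscale_def sum_distrib_left mult.assoc)

lemma lin_ext_delta: "lin_ext h (delta x) = h x"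
  by (simp add: lin_ext_def delta_def if_distribR if_distrib cong: if_cong)

lemma lin_ext_conv:
  "lin_ext h (conv p q) = (\<Sum>x\<in>UNIV. \<Sum>y\<in>UNIV. p x * q y * h (x * y))"
proof -
  have "lin_ext h (conv p q)
      = (\<Sum>z\<in>UNIV. \<Sum>x\<in>UNIV. \<Sum>y\<in>UNIV. if x * y = z then p x * q y * h z else 0)"
    by (auto simp: lin_ext_def conv_def sum_distrib_right intro!: sum.cong)
  also have "\<dots> = (\<Sum>x\<in>UNIV. \<Sum>z\<in>UNIV. \<Sum>y\<in>UNIV. if x * y = z then p x * q y * h z else 0)"
    by (rule sum.swap)
  also have "\<dots> = (\<Sum>x\<in>UNIV. \<Sum>y\<in>UNIV. \<Sum>z\<in>UNIV. if x * y = z then p x * q y * h z else 0)"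
    by (intro sum.cong refl sum.swap)
  finally show ?thesis by simp
qed

text \<open>Characters of the monoid extend to algebra homomorphisms to k, so they take only the
  values 0 and 1 on idempotents of kM.\<close>

lemma lin_ext_conv_mult:
  assumes "\<And>a b. h (a * b) = h a * h b"
  shows "lin_ext h (conv p q) = lin_ext h p * lin_ext h q"
  unfolding lin_ext_conv by (simp add: lin_ext_def assms sum_product algebra_simps)

text \<open>Taking a coefficient is itself a linear extension, that of \<open>delta z\<close>; this
  form lets \<open>lin_ext_conv\<close> handle iterated products.\<close>

lemma conv_eq: "conv p q z = (\<Sum>x\<in>UNIV. \<Sum>y\<in>UNIV. p x * q y * delta z (x * y))"
  by (auto simp: conv_def delta_def intro!: sum.cong)

lemma conv_assoc: "conv (conv p q) r = conv p (conv q r)"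
proof
  fix z
  have "conv (conv p q) r z
      = (\<Sum>w\<in>UNIV. conv p q w * (\<Sum>c\<in>UNIV. r c * delta z (w * c)))"
    by (simp add: conv_eq[of "conv p q"] sum_distrib_left mult.assoc)
  also have "\<dots> = lin_ext (\<lambda>w. \<Sum>c\<in>UNIV. r c * delta z (w * c)) (conv p q)"
    by (simp add: lin_ext_def)
  also have "\<dots> = (\<Sum>x\<in>UNIV. p x * (\<Sum>y\<in>UNIV. \<Sum>c\<in>UNIV. q y * r c * delta z (x * (y * c))))"
    unfolding lin_ext_conv by (simp add: sum_distrib_left mult.assoc)
  also have "\<dots> = (\<Sum>x\<in>UNIV. p x * lin_ext (\<lambda>w. delta z (x * w)) (conv q r))"
    unfolding lin_ext_conv ..
  also have "\<dots> = conv p (conv q r) z"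
    by (simp add: conv_eq[of p] lin_ext_def sum_distrib_left mult.assoc)
  finally show "conv (conv p q) r z = conv p (conv q r) z" .
qed

lemma conv_add_left: "conv (p + q) r = conv p r + conv q r"
  by (rule ext) (simp add: conv_eq algebra_simps sum.distrib)

lemma conv_add_right: "conv p (q + r) = conv p q + conv p r"
  by (rule ext) (simp add: conv_eq algebra_simps sum.distrib)

lemma conv_zero_left: "conv 0 q = 0"
  by (rule ext) (simp add: conv_eq)

lemma conv_zero_right: "conv p 0 = 0"
  by (rule ext) (simp add: conv_eq)

lemma conv_scale_left: "conv (fscale c p) q = fscale c (conv p q)"
  by (rule ext) (simp add: conv_eq fscale_def sum_distrib_left algebra_simps)

lemma conv_scale_right: "conv p (fscale c q) = fscale c (conv p q)"
  by (rule ext) (simp add: conv_eq fscale_def sum_distrib_left algebra_simps)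

lemma lmul_eq: "lmul m q z = (\<Sum>y\<in>UNIV. q y * delta z (m * y))"
  unfolding lmul_def by (rule sum.mono_neutral_cong_left) (auto simp: delta_def)

text \<open>Submodules and homomorphisms are defined by the action of monoid elements; this passes
  to the action of all of kM.\<close>

lemma conv_eq_sum_lmul: "conv p q = (\<Sum>x\<in>UNIV. fscale (p x) (lmul x q))"
  by (rule ext) (simp add: conv_eq sum_fun_apply fscale_def lmul_eq sum_distrib_left mult.assoc)

lemma conv_delta_eq: "conv (delta m) q = lmul m q"
  by (rule ext) (simp add: conv_eq_sum_lmul sum_fun_apply fscale_def sum_delta_mult)

lemma lmul_one: "lmul 1 q = q"
  by (simp add: lmul_def)

lemma lmul_lmul: "lmul a (lmul b q) = lmul (a * b) q"
proof -
  have "conv (delta a) (delta b) = delta (a * b)"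
    unfolding conv_delta_eq by (auto simp: lmul_def delta_def)
  then show ?thesis by (metis conv_assoc conv_delta_eq)
qed

lemma conv_delta_one_right:
  fixes p :: "'m::{monoid_mult,finite} \<Rightarrow> 'k::field"
  shows "conv p (delta 1) = p"
proof
  fix z :: 'm
  have "lmul x (delta 1) z = (delta z x :: 'k)" for x
    unfolding lmul_eq by (simp add: sum_delta_mult)
  then have "conv p (delta 1) z = (\<Sum>x\<in>UNIV. delta z x * p x)"
    unfolding conv_eq_sum_lmul by (simp add: sum_fun_apply fscale_def mult.commute)
  then show "conv p (delta 1) z = p z" by (simp add: sum_delta_mult)
qed

section \<open>Submodules of kM and dimension counts\<close>

lemma kM_submodule_iff:
  "kM_submodule N \<longleftrightarrow> fs.subspace N \<and> (\<forall>m. \<forall>p\<in>N. lmul m p \<in> N)"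
  unfolding kM_submodule_def fs.subspace_def fscale_def zero_fun_def plus_fun_def by blast

lemma kM_submodule_conv:
  assumes "kM_submodule N" "p \<in> N"
  shows "conv a p \<in> N"
  unfolding conv_eq_sum_lmul using assms unfolding kM_submodule_iff
  by (intro fs.subspace_sum fs.subspace_scale) auto

lemma linear_conv_left: "Vector_Spaces.linear fscale fscale (conv a)"
  by unfold_locales (simp_all add: conv_add_right conv_scale_right)

lemma linear_conv_right: "Vector_Spaces.linear fscale fscale (\<lambda>p. conv p a)"
  by unfold_locales (simp_all add: conv_add_left conv_scale_left)

text \<open>Subtracting f(x)/f(a) times \<open>a\<close> moves any \<open>x\<close> into the kernel,
  so the kernel and \<open>a\<close> together span \<open>A\<close>.\<close>

lemma dim_kernel_functional:
  fixes A :: "('m::finite \<Rightarrow> 'k::field) set"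
  assumes A: "fs.subspace A" and a: "a \<in> A" "f a \<noteq> 0"
    and add: "\<And>x y. f (x + y) = f x + f y"
    and scale: "\<And>c x. f (fscale c x) = c * f x"
  shows "fs.dim A = fs.dim {x\<in>A. f x = (0::'k)} + 1"
proof -
  let ?K = "{x\<in>A. f x = 0}"
  have f0: "f 0 = 0" using scale[of 0 0] by simp
  have K: "fs.subspace ?K"
    using A f0 add scale unfolding fs.subspace_def by auto
  have "A \<subseteq> fs.span (insert a ?K)"
  proof
    fix x assume x: "x \<in> A"
    define c where "c = f x / f a"
    have "f (x - fscale c a) = 0"
      using add[of "x - fscale c a" "fscale c a"] scale[of c a] a unfolding c_def by simp
    then have "x - fscale c a \<in> ?K"
      using A x a by (auto intro: fs.subspace_diff fs.subspace_scale)
    then have "x - fscale c a + fscale c a \<in> fs.span (insert a ?K)"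
      by (intro fs.span_add fs.span_scale fs.span_base) auto
    then show "x \<in> fs.span (insert a ?K)" by simp
  qed
  moreover have "fs.span (insert a ?K) \<subseteq> A"
    using A a by (intro fs.span_minimal) auto
  ultimately have "fs.dim A = fs.dim (insert a ?K)"
    by (metis fs.dim_span subset_antisym)
  moreover have "a \<notin> fs.span ?K"
    using K a by (metis (mono_tags, lifting) fs.span_eq_iff mem_Collect_eq)
  ultimately show ?thesis by (simp add: fs.dim_insert)
qed

text \<open>One step of both triangular rank counts: \<open>f\<close> is an eigenfunctional of the
  idempotent \<open>T\<close> with eigenvalue \<open>c\<close>. Since \<open>T\<close> fixes its
  image, the kernel of \<open>f\<close> on the image is the image of the kernel, and
  \<open>f\<close> is nonzero on the image exactly when \<open>c\<close> is.\<close>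

lemma dim_image_idempotent_step:
  fixes V :: "('m::finite \<Rightarrow> 'k::field) set"
  assumes V: "fs.subspace V" and T: "Vector_Spaces.linear fscale fscale T"
    and TV: "\<And>v. v \<in> V \<Longrightarrow> T v \<in> V" and TT: "\<And>v. v \<in> V \<Longrightarrow> T (T v) = T v"
    and add: "\<And>x y. f (x + y) = f x + f y"
    and scale: "\<And>c x. f (fscale c x) = c * f x"
    and f: "\<And>v. v \<in> V \<Longrightarrow> f (T v) = c * f v" and v: "v \<in> V" "f v \<noteq> 0"
  shows "fs.dim (T ` V) = fs.dim (T ` {x\<in>V. f x = 0}) + (if c \<noteq> 0 then 1 else 0)"
proof -
  interpret vector_space_pair
    "fscale :: 'k \<Rightarrow> ('m \<Rightarrow> 'k) \<Rightarrow> _" "fscale :: 'k \<Rightarrow> ('m \<Rightarrow> 'k) \<Rightarrow> _" ..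
  have sub: "fs.subspace (T ` V)"
    using T V by (rule linear_subspace_image)
  have ker: "{x \<in> T ` V. f x = 0} = T ` {x\<in>V. f x = 0}"
  proof (intro equalityI subsetI)
    fix x assume "x \<in> {x \<in> T ` V. f x = 0}"
    then have "x = T x" "x \<in> V" "f x = 0" using TT TV by auto
    then show "x \<in> T ` {x\<in>V. f x = 0}" by blast
  qed (use f in auto)
  show ?thesis
  proof (cases "c = 0")
    case True
    then have "{x \<in> T ` V. f x = 0} = T ` V" using f by auto
    then show ?thesis using ker True by simp
  next
    case False
    then have "f (T v) \<noteq> 0" using f v by simp
    then show ?thesis
      using dim_kernel_functional[of "T ` V" "T v" f, OF sub _ _ add scale] v(1) ker False by simp
  qed
qed

section \<open>Projective covers and multiplicities\<close>

text \<open>The number \<open>\<mu> Z\<close> is the multiplicity of S_Z in a filtration of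
  \<open>V\<close> with one-dimensional quotients. One choice serves all idempotents
  \<open>a\<close>, because the filtration is built without reference to \<open>a\<close>.\<close>

lemma submodule_multiplicities:
  fixes V :: "('m::{monoid_mult,finite} \<Rightarrow> 'k::field) set"
  assumes R: "R_trivial TYPE('m)" and "kM_submodule V"
  shows "\<exists>\<mu>. \<forall>a. conv a a = a \<longrightarrow> fs.dim (conv a ` V)
    = (\<Sum>Z\<in>Lambda. if lin_ext (char_S Z) a \<noteq> 0 then \<mu> Z else 0)"
  using assms(2)
proof (induction "fs.dim V" arbitrary: V rule: less_induct)
  case less
  note V = less.prems
  have Vs: "fs.subspace V" and Vl: "\<And>x v. v \<in> V \<Longrightarrow> lmul x v \<in> V"
    using V unfolding kM_submodule_iff by auto
  show ?case
  proof (cases "V \<subseteq> {0}")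
    case True
    have "conv a ` V \<subseteq> {0}" for a
      using True conv_zero_right by auto
    then have "fs.dim (conv a ` V) = 0" for a by (simp only: fs.dim_eq_0)
    then show ?thesis by (intro exI[of _ "\<lambda>_. 0"]) simp
  next
    case False
    define r where "r = (\<lambda>m::'m. card (range (\<lambda>x. m * x)))"
    have "\<exists>v\<in>V. lmul 1 v \<noteq> 0" using False by (auto simp: lmul_one)
    \<comment> \<open>Among the elements not annihilating \<open>V\<close>, one with the smallest
      right ideal.\<close>
    then obtain m where m: "\<exists>v\<in>V. lmul m v \<noteq> 0"
      and min: "\<And>n. \<exists>v\<in>V. lmul n v \<noteq> 0 \<Longrightarrow> r m \<le> r n"
      using ex_has_least_nat[of "\<lambda>m. \<exists>v\<in>V. lmul m v \<noteq> 0" 1 r] by auto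
    \<comment> \<open>A coordinate \<open>z\<close> where m acts nontrivially turns the
      vector-valued map v |-> mv into a nonzero functional on \<open>V\<close>.\<close>
    obtain v z where v: "v \<in> V" "lmul m v z \<noteq> 0"
      using m by (metis ext zero_fun_apply)
    define f where "f = (\<lambda>v :: 'm \<Rightarrow> 'k. lmul m v z)"
    \<comment> \<open>Either \<open>m * x\<close> still acts nontrivially and minimality forces it
      to equal \<open>m\<close>, or it annihilates \<open>V\<close> and so differs from
      \<open>m\<close>.\<close>
    have key: "f (lmul x u) = (if m * x = m then 1 else 0) * f u" if u: "u \<in> V" for x u
    proof (cases "\<exists>v\<in>V. lmul (m * x) v \<noteq> 0")
      case True
      then have "r m \<le> r (m * x)" by (rule min)
      moreover have "range (\<lambda>y. m * x * y) \<subseteq> range (\<lambda>y. m * y)"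
        by (auto simp: mult.assoc)
      ultimately have "range (\<lambda>y. m * x * y) = range (\<lambda>y. m * y)"
        unfolding r_def by (intro card_seteq) auto
      then have "m * x = m" using R unfolding R_trivial_def by blast
      then show ?thesis by (simp add: f_def lmul_lmul)
    next
      case False
      then have "m * x \<noteq> m" using m by auto
      then show ?thesis using False u by (simp add: f_def lmul_lmul)
    qed
    interpret L: Vector_Spaces.linear fscale fscale "conv (delta m :: 'm \<Rightarrow> 'k)"
      by (rule linear_conv_left)
    have fadd: "f (x + y) = f x + f y" for x y
      unfolding f_def conv_delta_eq[symmetric] L.add by simp
    have fscale: "f (fscale c x) = c * f x" for c x
      unfolding f_def conv_delta_eq[symmetric] L.scale by (simp add: fscale_def)
    have fsum: "f (sum g A) = (\<Sum>x\<in>A. f (g x))" for g and A :: "'m set"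
      unfolding f_def conv_delta_eq[symmetric] L.sum by (simp add: sum_fun_apply)
    obtain Z0 where Z0: "Z0 \<in> Lambda" "(char_S Z0 :: 'm \<Rightarrow> 'k) = (\<lambda>x. if m * x = m then 1 else 0)"
      using fix_character_eq_char_S[OF R, of m] by blast
    have fconv: "f (conv a u) = lin_ext (char_S Z0) a * f u" if "u \<in> V" for a u
      unfolding conv_eq_sum_lmul fsum fscale lin_ext_def Z0(2)
      using key[OF that] by (simp add: sum_distrib_right mult.assoc)
    let ?W = "{x\<in>V. f x = 0}"
    have f0: "f 0 = 0" using fscale[of 0 0] by simp
    have "fs.subspace ?W"
      using Vs f0 fadd fscale unfolding fs.subspace_def by auto
    \<comment> \<open>The kernel of an eigenfunctional of all monoid elements is stable; the
      quotient of \<open>V\<close> by it is S_Z0.\<close>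
    then have W: "kM_submodule ?W"
      unfolding kM_submodule_iff using Vl key by auto
    have v0: "f v \<noteq> 0" using v by (simp add: f_def)
    have "fs.dim ?W < fs.dim V"
      using dim_kernel_functional[of V v f, OF Vs v(1) v0 fadd fscale] by simp
    from less.hyps[OF this W] obtain \<mu> where
      \<mu>: "\<And>a. conv a a = a \<Longrightarrow> fs.dim (conv a ` ?W)
        = (\<Sum>Z\<in>Lambda. if lin_ext (char_S Z) a \<noteq> 0 then \<mu> Z else 0)" by blast
    show ?thesis
    proof (intro exI[of _ "\<mu>(Z0 := \<mu> Z0 + 1)"] allI impI)
      fix a :: "'m \<Rightarrow> 'k" assume a: "conv a a = a"
      have "fs.dim (conv a ` V)
          = fs.dim (conv a ` ?W) + (if lin_ext (char_S Z0) a \<noteq> 0 then 1 else 0)"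
        using a conv_assoc[of a a] kM_submodule_conv[OF V] fconv v(1) v0
        by (intro dim_image_idempotent_step[OF Vs linear_conv_left _ _ fadd fscale]) auto
      also have "\<dots> = (\<Sum>Z\<in>Lambda. if lin_ext (char_S Z) a \<noteq> 0 then \<mu> Z else 0)
          + (\<Sum>Z\<in>Lambda. if Z = Z0 then if lin_ext (char_S Z) a \<noteq> 0 then 1 else 0 else 0)"
        using Z0(1) by (simp add: \<mu>[OF a])
      also have "\<dots> = (\<Sum>Z\<in>Lambda. if lin_ext (char_S Z) a \<noteq> 0 then (\<mu>(Z0 := \<mu> Z0 + 1)) Z else 0)"
        unfolding sum.distrib[symmetric] by (intro sum.cong) auto
      finally show "fs.dim (conv a ` V)
        = (\<Sum>Z\<in>Lambda. if lin_ext (char_S Z) a \<noteq> 0 then (\<mu>(Z0 := \<mu> Z0 + 1)) Z else 0)" .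
    qed
  qed
qed

text \<open>The functions supported on the right ideal \<open>U\<close> form a right submodule of
  kM. The elements of \<open>U\<close> are split off one by one, each contributing its diagonal
  entry to the rank of right multiplication by \<epsilon>.\<close>

lemma dim_right_ideal_idempotent:
  fixes \<epsilon> :: "'m::{monoid_mult,finite} \<Rightarrow> 'k::field"
  assumes R: "R_trivial TYPE('m)" and \<epsilon>: "conv \<epsilon> \<epsilon> = \<epsilon>"
    and "\<And>n m. n \<in> U \<Longrightarrow> n * m \<in> U"
  shows "fs.dim ((\<lambda>p. conv p \<epsilon>) ` {p. \<forall>x. x \<notin> U \<longrightarrow> p x = 0})
    = card {n\<in>U. lin_ext (\<lambda>m. if n * m = n then 1 else 0) \<epsilon> \<noteq> 0}"
  using finite[of U] assms(3)
proof (induction U rule: finite_psubset_induct)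
  case (psubset U)
  note U = psubset.prems
  show ?case
  proof (cases "U = {}")
    case True
    then have eq: "{p. \<forall>x. x \<notin> U \<longrightarrow> p x = 0} = {0 :: 'm \<Rightarrow> 'k}" by auto
    have "(\<lambda>p. conv p \<epsilon>) ` {p. \<forall>x. x \<notin> U \<longrightarrow> p x = 0} \<subseteq> {0}"
      unfolding eq by (simp add: conv_zero_left)
    then have "fs.dim ((\<lambda>p. conv p \<epsilon>) ` {p. \<forall>x. x \<notin> U \<longrightarrow> p x = 0}) = 0"
      by (simp only: fs.dim_eq_0)
    moreover have "{n\<in>U. lin_ext (\<lambda>m. if n * m = n then 1 else 0) \<epsilon> \<noteq> 0} = {}"
      using True by blast
    ultimately show ?thesis by (simp only: card.empty)
  next
    case False
    define r where "r = (\<lambda>m::'m. card (range (\<lambda>x. m * x)))"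
    obtain n where n: "n \<in> U" and max: "\<And>u. u \<in> U \<Longrightarrow> r u \<le> r n"
    proof -
      have "Max (r ` U) \<in> r ` U" using False by (intro Max_in) auto
      then obtain n where "n \<in> U" "r n = Max (r ` U)" by auto
      then show thesis using that[of n] by simp
    qed
    \<comment> \<open>Here nM lies in uM, and the maximal size of nM makes them equal. So no other
      element of \<open>U\<close> reaches \<open>n\<close>.\<close>
    have mult_eq: "u = n" if u: "u \<in> U" and ux: "u * x = n" for u x
    proof -
      have "range (\<lambda>y. n * y) \<subseteq> range (\<lambda>y. u * y)"
        using ux by (auto simp: mult.assoc)
      then have "range (\<lambda>y. n * y) = range (\<lambda>y. u * y)"
        using max[OF u] unfolding r_def by (intro card_seteq) auto
      then show ?thesis using R unfolding R_trivial_def by metis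
    qed
    define c where "c = lin_ext (\<lambda>m. if n * m = n then 1 else 0) \<epsilon>"
    let ?V = "{p :: 'm \<Rightarrow> 'k. \<forall>x. x \<notin> U \<longrightarrow> p x = 0}"
    have Vs: "fs.subspace ?V"
      unfolding fs.subspace_def by (auto simp: fscale_def)
    have TV: "conv p \<epsilon> \<in> ?V" if "p \<in> ?V" for p
    proof -
      have "conv p \<epsilon> z = 0" if z: "z \<notin> U" for z
        unfolding conv_def using \<open>p \<in> ?V\<close> U z
        by (intro sum.neutral ballI) auto
      then show ?thesis by blast
    qed
    \<comment> \<open>By \<open>mult_eq\<close> only the summand \<open>x = n\<close> contributes to
      the coefficient at \<open>n\<close>, so evaluation at \<open>n\<close> is an
      eigenfunctional.\<close>
    have fT: "conv p \<epsilon> n = c * p n" if p: "p \<in> ?V" for p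
    proof -
      have "conv p \<epsilon> n = (\<Sum>x\<in>UNIV. if x = n then \<Sum>y\<in>UNIV. if n * y = n then p n * \<epsilon> y else 0 else 0)"
      proof -
        have "(if x * y = n then p x * \<epsilon> y else 0) = (if x = n then if n * y = n then p n * \<epsilon> y else 0 else 0)"
          for x y using mult_eq[of x y] p n by (cases "x \<in> U") auto
        then have "conv p \<epsilon> n
            = (\<Sum>x\<in>UNIV. \<Sum>y\<in>UNIV. if x = n then if n * y = n then p n * \<epsilon> y else 0 else 0)"
          unfolding conv_def by (intro sum.cong refl)
        also have "\<dots> = (\<Sum>x\<in>UNIV. if x = n then \<Sum>y\<in>UNIV. if n * y = n then p n * \<epsilon> y else 0 else 0)"
          by (intro sum.cong refl) simp
        finally show ?thesis .
      qed
      also have "\<dots> = c * p n"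
        by (auto simp: c_def lin_ext_def sum_distrib_right intro!: sum.cong)
      finally show ?thesis .
    qed
    have "fs.dim ((\<lambda>p. conv p \<epsilon>) ` ?V)
        = fs.dim ((\<lambda>p. conv p \<epsilon>) ` {p\<in>?V. p n = 0}) + (if c \<noteq> 0 then 1 else 0)"
      using TV fT n
      by (intro dim_image_idempotent_step[OF Vs linear_conv_right, of _ "\<lambda>p. p n" c "delta n"])
        (auto simp: conv_assoc \<epsilon> fscale_def delta_def)
    also have "{p\<in>?V. p n = 0} = {p. \<forall>x. x \<notin> U - {n} \<longrightarrow> p x = 0}"
      by auto
    also have "fs.dim ((\<lambda>p. conv p \<epsilon>) ` {p. \<forall>x. x \<notin> U - {n} \<longrightarrow> p x = 0})
        = card {u\<in>U - {n}. lin_ext (\<lambda>m. if u * m = u then 1 else 0) \<epsilon> \<noteq> 0}"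
    proof (rule psubset.IH)
      show "U - {n} \<subset> U" using n by auto
      \<comment> \<open>Removing \<open>n\<close> leaves a right ideal, again by
        \<open>mult_eq\<close>.\<close>
      show "u * m \<in> U - {n}" if "u \<in> U - {n}" for u m using that U mult_eq by blast
    qed
    also have "\<dots> + (if c \<noteq> 0 then 1 else 0)
        = card {n\<in>U. lin_ext (\<lambda>m. if n * m = n then 1 else 0) \<epsilon> \<noteq> 0}"
    proof -
      have "{n\<in>U. lin_ext (\<lambda>m. if n * m = n then 1 else 0) \<epsilon> \<noteq> 0}
          = (if c \<noteq> 0 then {n} else {})
            \<union> {u\<in>U - {n}. lin_ext (\<lambda>m. if u * m = u then 1 else 0) \<epsilon> \<noteq> 0}"
        using n by (auto simp: c_def)
      then show ?thesis by auto
    qed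
    finally show ?thesis .
  qed
qed

section \<open>Homomorphisms out of a projective cover\<close>

lemma additive_on_sum:
  fixes \<phi> :: "('m \<Rightarrow> 'k::field) \<Rightarrow> 'b::ab_group_add"
  assumes P: "fs.subspace P" and add: "\<And>p q. p \<in> P \<Longrightarrow> q \<in> P \<Longrightarrow> \<phi> (p + q) = \<phi> p + \<phi> q"
    and "finite A" "\<And>x. x \<in> A \<Longrightarrow> g x \<in> P"
  shows "\<phi> (sum g A) = (\<Sum>x\<in>A. \<phi> (g x))"
  using assms(3,4)
proof (induction A rule: finite_induct)
  case empty
  show ?case using add[of 0 0] P by (metis add_cancel_right_right fs.subspace_0 sum.empty)
next
  case (insert x A)
  have "\<phi> (sum g (insert x A)) = \<phi> (g x) + \<phi> (sum g A)"
    unfolding sum.insert[OF insert.hyps] using insert.prems P by (intro add fs.subspace_sum) auto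
  also have "\<phi> (sum g A) = (\<Sum>x\<in>A. \<phi> (g x))" using insert by blast
  finally show ?case unfolding sum.insert[OF insert.hyps] .
qed

lemma kM_Hom_iff:
  "\<phi> \<in> kM_Hom P Q \<longleftrightarrow> (\<forall>p\<in>P. \<phi> p \<in> Q) \<and> (\<forall>p. p \<notin> P \<longrightarrow> \<phi> p = (\<lambda>_. 0))
     \<and> (\<forall>p\<in>P. \<forall>q\<in>P. \<phi> (p + q) = \<phi> p + \<phi> q)
     \<and> (\<forall>c. \<forall>p\<in>P. \<phi> (fscale c p) = fscale c (\<phi> p))
     \<and> (\<forall>m. \<forall>p\<in>P. \<phi> (lmul m p) = lmul m (\<phi> p))"
  unfolding kM_Hom_def fscale_def plus_fun_def by (rule mem_Collect_eq)

text \<open>Since P = kM\<epsilon>, a homomorphism is right multiplication by the image of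
  \<epsilon>, and that image lies in \<epsilon>Q because \<epsilon> is idempotent.\<close>

lemma hom_dim_eq:
  fixes P Q :: "('m::{monoid_mult,finite} \<Rightarrow> 'k::field) set"
  assumes P: "kM_submodule P" and Q: "kM_submodule Q"
    and \<epsilon>: "\<epsilon> \<in> P" "\<And>p. p \<in> P \<Longrightarrow> conv p \<epsilon> = p"
  shows "hom_dim P Q = fs.dim (conv \<epsilon> ` Q)"
proof -
  define s where "s = (\<lambda>(c::'k) (\<phi> :: ('m \<Rightarrow> 'k) \<Rightarrow> ('m \<Rightarrow> 'k)). (\<lambda>p z. c * \<phi> p z))"
  have s: "vector_space s"
    by unfold_locales (auto simp: s_def fun_eq_iff algebra_simps)
  interpret pair: finite_dimensional_vector_space_pair_1 fscale "range (delta :: 'm \<Rightarrow> 'm \<Rightarrow> 'k)" s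
    using s by (simp add: finite_dimensional_vector_space_pair_1_def fs.finite_dimensional_vector_space_axioms)
  have Ps: "fs.subspace P" and Qs: "fs.subspace Q"
    using P Q unfolding kM_submodule_iff by auto
  \<comment> \<open>Right multiplication by \<open>v\<close> on \<open>P\<close>, with the value 0
    outside \<open>P\<close> that \<open>kM_Hom\<close> prescribes.\<close>
  define \<Psi> where "\<Psi> = (\<lambda>v p. if p \<in> P then conv p v else (\<lambda>_. 0))"
  have lin: "Vector_Spaces.linear fscale s \<Psi>"
    by unfold_locales
      (auto simp: \<Psi>_def s_def fun_eq_iff conv_add_right conv_scale_right, auto simp: fscale_def)
  interpret L: Vector_Spaces.linear fscale fscale "conv \<epsilon>"
    by (rule linear_conv_left)
  have sub: "fs.subspace (conv \<epsilon> ` Q)"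
    using Qs by (rule L.subspace_image)
  have \<epsilon>\<epsilon>: "conv \<epsilon> \<epsilon> = \<epsilon>" using \<epsilon> by blast
  have inj: "inj_on \<Psi> (fs.span (conv \<epsilon> ` Q))"
  proof -
    \<comment> \<open>Evaluation at \<epsilon> recovers \<open>v\<close>, whence
      injectivity.\<close>
    have "\<Psi> v \<epsilon> = v" if "v \<in> conv \<epsilon> ` Q" for v
      using that \<epsilon>(1) \<epsilon>\<epsilon> by (auto simp: \<Psi>_def conv_assoc[symmetric])
    moreover have "fs.span (conv \<epsilon> ` Q) = conv \<epsilon> ` Q"
      using sub by (rule fs.span_eq_iff[THEN iffD2])
    ultimately show ?thesis by (metis inj_on_def)
  qed
  have "kM_Hom P Q = \<Psi> ` (conv \<epsilon> ` Q)"
  proof (intro equalityI subsetI)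
    fix \<phi> assume "\<phi> \<in> kM_Hom P Q"
    then have PQ: "\<And>p. p \<in> P \<Longrightarrow> \<phi> p \<in> Q" and zero: "\<And>p. p \<notin> P \<Longrightarrow> \<phi> p = (\<lambda>_. 0)"
      and add: "\<And>p q. p \<in> P \<Longrightarrow> q \<in> P \<Longrightarrow> \<phi> (p + q) = \<phi> p + \<phi> q"
      and scale: "\<And>c p. p \<in> P \<Longrightarrow> \<phi> (fscale c p) = fscale c (\<phi> p)"
      and lmul: "\<And>m p. p \<in> P \<Longrightarrow> \<phi> (lmul m p) = lmul m (\<phi> p)"
      unfolding kM_Hom_iff by blast+
    have Pl: "lmul x \<epsilon> \<in> P" for x using P \<epsilon>(1) unfolding kM_submodule_iff by blast
    have conv: "\<phi> (conv p \<epsilon>) = conv p (\<phi> \<epsilon>)" for p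
    proof -
      have "\<phi> (conv p \<epsilon>) = (\<Sum>x\<in>UNIV. \<phi> (fscale (p x) (lmul x \<epsilon>)))"
        unfolding conv_eq_sum_lmul
        by (rule additive_on_sum[OF Ps, of \<phi>, OF add]) (simp_all add: fs.subspace_scale[OF Ps] Pl)
      also have "\<dots> = conv p (\<phi> \<epsilon>)"
        unfolding conv_eq_sum_lmul scale[OF Pl] lmul[OF \<epsilon>(1)] ..
      finally show ?thesis .
    qed
    have "\<phi> = \<Psi> (\<phi> \<epsilon>)"
    proof
      show "\<phi> p = \<Psi> (\<phi> \<epsilon>) p" for p
        using zero[of p] conv[of p] \<epsilon>(2)[of p] by (cases "p \<in> P") (simp_all add: \<Psi>_def)
    qed
    moreover have "\<phi> \<epsilon> = conv \<epsilon> (\<phi> \<epsilon>)" using conv \<epsilon>\<epsilon> by metis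
    ultimately show "\<phi> \<in> \<Psi> ` (conv \<epsilon> ` Q)" using PQ \<epsilon>(1) by blast
  next
    fix \<phi> assume "\<phi> \<in> \<Psi> ` (conv \<epsilon> ` Q)"
    then obtain q where q: "q \<in> Q" "\<phi> = \<Psi> (conv \<epsilon> q)" by blast
    have "conv p (conv \<epsilon> q) \<in> Q" for p
      using Q q(1) by (intro kM_submodule_conv)
    moreover have "conv (lmul m p) v = lmul m (conv p v)" for m and p v :: "'m \<Rightarrow> 'k"
      by (metis conv_assoc conv_delta_eq)
    moreover have "p + p' \<in> P" "fscale c p \<in> P" "lmul m p \<in> P" if "p \<in> P" "p' \<in> P" for p p' c m
      using P that unfolding kM_submodule_iff by (auto simp: fs.subspace_add fs.subspace_scale)
    ultimately show "\<phi> \<in> kM_Hom P Q"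
      unfolding kM_Hom_iff q(2) \<Psi>_def by (simp add: conv_add_left conv_scale_left del: plus_fun_apply)
  qed
  then have "hom_dim P Q = vector_space.dim s (\<Psi> ` (conv \<epsilon> ` Q))"
    unfolding hom_dim_def s_def by simp
  also have "\<dots> = fs.dim (conv \<epsilon> ` Q)"
    using lin inj by (rule pair.dim_image_eq)
  finally show ?thesis .
qed

text \<open>The idempotent is the component in \<open>P\<close> of the unit of kM. If the character
  of some other Z were nonzero on it, the kernel of that character in \<open>P\<close> would be a
  proper submodule still mapping onto S_X, against essentiality.\<close>

lemma proj_cover_idempotent:
  fixes P :: "('m::{monoid_mult,finite} \<Rightarrow> 'k::field) set"
  assumes R: "R_trivial TYPE('m)" and X: "X \<in> Lambda" and cover: "proj_cover X P"
  obtains \<epsilon> where "\<epsilon> \<in> P" "\<And>p. p \<in> P \<Longrightarrow> conv p \<epsilon> = p"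
    "\<And>Z. Z \<in> Lambda \<Longrightarrow> lin_ext (char_S Z) \<epsilon> = (if Z = X then 1 else 0)"
proof -
  have P: "kM_submodule P" using cover unfolding proj_cover_def by (elim conjE)
  obtain Q where Q: "kM_submodule Q" and PQ: "P \<inter> Q = {0}"
    and sum: "\<And>a. \<exists>p\<in>P. \<exists>q\<in>Q. a = p + q"
    using cover unfolding proj_cover_def plus_fun_def zero_fun_def by (elim conjE exE) blast
  obtain \<pi> :: "('m \<Rightarrow> 'k) \<Rightarrow> 'k" where \<pi>':
    "\<forall>p\<in>P. \<forall>q\<in>P. \<pi> (\<lambda>z. p z + q z) = \<pi> p + \<pi> q"
    "\<forall>c. \<forall>p\<in>P. \<pi> (\<lambda>z. c * p z) = c * \<pi> p"
    "\<forall>m. \<forall>p\<in>P. \<pi> (lmul m p) = char_S X m * \<pi> p"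
    "\<forall>c. \<exists>p\<in>P. \<pi> p = c"
    "\<forall>N. kM_submodule N \<and> N \<subseteq> P
      \<and> (\<forall>p\<in>P. \<exists>n\<in>N. \<exists>q\<in>P. \<pi> q = 0 \<and> p = (\<lambda>z. n z + q z)) \<longrightarrow> N = P"
    using cover unfolding proj_cover_def by (elim conjE exE) (rule that)
  have add: "\<pi> (p + q) = \<pi> p + \<pi> q" if "p \<in> P" "q \<in> P" for p q
    using \<pi>'(1) that unfolding plus_fun_def by blast
  have scale: "\<pi> (fscale c p) = c * \<pi> p" if "p \<in> P" for c p
    using \<pi>'(2) that unfolding fscale_def by blast
  have lmul: "\<pi> (lmul m p) = char_S X m * \<pi> p" if "p \<in> P" for m p
    using \<pi>'(3) that by blast
  have ess: "N = P" if "kM_submodule N" "N \<subseteq> P"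
    "\<And>p. p \<in> P \<Longrightarrow> \<exists>n\<in>N. \<exists>q\<in>P. \<pi> q = 0 \<and> p = n + q" for N
    using \<pi>'(5) that unfolding plus_fun_def by blast
  have Ps: "fs.subspace P" and Qs: "fs.subspace Q"
    using P Q unfolding kM_submodule_iff by auto
  have Pl: "lmul x p \<in> P" if "p \<in> P" for x p
    using P that unfolding kM_submodule_iff by blast
  obtain \<epsilon> \<eta> where \<epsilon>: "\<epsilon> \<in> P" and \<eta>: "\<eta> \<in> Q" and one: "delta 1 = \<epsilon> + \<eta>"
    using sum by blast
  \<comment> \<open>The component p\<eta> = p - p\<epsilon> lies in both summands, hence
    vanishes.\<close>
  have fixed: "conv p \<epsilon> = p" if p: "p \<in> P" for p
  proof -
    have eq: "p = conv p \<epsilon> + conv p \<eta>"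
      using conv_delta_one_right[of p] unfolding one conv_add_right by simp
    have "conv p \<eta> = p - conv p \<epsilon>" using eq by (metis add_diff_cancel_left')
    then have "conv p \<eta> \<in> P"
      using Ps p kM_submodule_conv[OF P \<epsilon>] by (simp add: fs.subspace_diff)
    then have "conv p \<eta> = 0" using kM_submodule_conv[OF Q \<eta>] PQ by blast
    then show ?thesis using eq by simp
  qed
  \<comment> \<open>As p = p\<epsilon>, the map \<open>\<pi>\<close> is a scalar multiple of the
    character of X on \<open>P\<close>; surjectivity makes the scalar nonzero.\<close>
  have \<pi>: "\<pi> p = lin_ext (char_S X) p * \<pi> \<epsilon>" if p: "p \<in> P" for p
  proof -
    have "\<pi> p = \<pi> (conv p \<epsilon>)" using fixed[OF p] by simp
    also have "\<dots> = (\<Sum>x\<in>UNIV. \<pi> (fscale (p x) (lmul x \<epsilon>)))"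
      unfolding conv_eq_sum_lmul
      by (rule additive_on_sum[OF Ps, of \<pi>, OF add]) (simp_all add: fs.subspace_scale[OF Ps] Pl[OF \<epsilon>])
    also have "\<dots> = lin_ext (char_S X) p * \<pi> \<epsilon>"
      using scale lmul Pl \<epsilon> by (simp add: lin_ext_def sum_distrib_right mult.assoc)
    finally show ?thesis .
  qed
  have "\<pi> \<epsilon> \<noteq> 0" using \<pi>'(4) \<pi> by (metis mult_zero_right zero_neq_one)
  then have \<epsilon>X: "lin_ext (char_S X) \<epsilon> = 1" using \<pi>[OF \<epsilon>] by simp
  have char_conv: "lin_ext (char_S Z) (conv a b) = lin_ext (char_S Z) a * lin_ext (char_S Z) b"
    if "Z \<in> Lambda" for Z and a b :: "'m \<Rightarrow> 'k"
    using that char_S_mult[OF R that] by (intro lin_ext_conv_mult)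
  have "lin_ext (char_S Z) \<epsilon> = 0" if Z: "Z \<in> Lambda" and "Z \<noteq> X" for Z
  proof (rule ccontr)
    assume nz: "lin_ext (char_S Z) \<epsilon> \<noteq> 0"
    have "lin_ext (char_S Z) \<epsilon> = lin_ext (char_S Z) \<epsilon> * lin_ext (char_S Z) \<epsilon>"
      using char_conv[OF Z, of \<epsilon> \<epsilon>] fixed[OF \<epsilon>] by simp
    then have \<epsilon>Z: "lin_ext (char_S Z) \<epsilon> = 1" using nz by simp
    let ?N = "{p\<in>P. lin_ext (char_S Z) p = 0}"
    have lin0: "lin_ext (char_S Z) (0 :: 'm \<Rightarrow> 'k) = 0" by (simp add: lin_ext_def)
    have "fs.subspace ?N"
      using Ps lin0 unfolding fs.subspace_def by (auto simp: lin_ext_add lin_ext_scale)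
    then have N: "kM_submodule ?N"
      unfolding kM_submodule_iff
      using Pl char_conv[OF Z] by (auto simp: conv_delta_eq[symmetric])
    have lm: "lin_ext (char_S W) (lmul m \<epsilon>) = char_S W m" if "W \<in> {X, Z}" for W m
      using that char_conv[of W "delta m" \<epsilon>] X Z \<epsilon>X \<epsilon>Z by (auto simp: conv_delta_eq lin_ext_delta)
    obtain m where m: "(char_S X m :: 'k) \<noteq> char_S Z m"
      using char_S_inj[OF R X Z] \<open>Z \<noteq> X\<close> by blast
    \<comment> \<open>An element of \<open>P\<close> on which the character of Z is 0 and that of X
      is 1: where the characters differ at \<open>m\<close>, their values are 1 and 0 in some order,
      and either m\<epsilon> or \<epsilon> - m\<epsilon> works.\<close>
    define w where "w = (if char_S X m = (1::'k) then lmul m \<epsilon> else \<epsilon> - lmul m \<epsilon>)"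
    have w: "w \<in> P" "lin_ext (char_S Z) w = 0" "lin_ext (char_S X) w = 1"
      using m Ps Pl[OF \<epsilon>] \<epsilon> lm \<epsilon>X \<epsilon>Z
      by (auto simp: w_def lin_ext_diff fs.subspace_diff char_S_def split: if_splits)
    have "?N = P"
    proof (rule ess[OF N])
      fix p assume p: "p \<in> P"
      \<comment> \<open>Subtracting the multiple \<open>c\<close> of \<open>w\<close> brings
        \<open>p\<close> into the kernel of \<open>\<pi>\<close>, so the submodule \<open>?N\<close>
        surjects onto S_X.\<close>
      define c where "c = lin_ext (char_S X) p"
      have "p - fscale c w \<in> P" using Ps p w by (simp add: fs.subspace_diff fs.subspace_scale)
      moreover from this have "\<pi> (p - fscale c w) = 0"
        using \<pi>[of "p - fscale c w"] w by (simp add: lin_ext_diff lin_ext_scale c_def)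
      moreover have "fscale c w \<in> ?N"
        using w Ps by (simp add: lin_ext_scale fs.subspace_scale)
      ultimately show "\<exists>n\<in>?N. \<exists>q\<in>P. \<pi> q = 0 \<and> p = n + q"
        by (intro bexI[of _ "fscale c w"] bexI[of _ "p - fscale c w"]) auto
    qed auto
    then show False using \<epsilon> nz by blast
  qed
  then show thesis using that[OF \<epsilon> fixed] \<epsilon>X by simp
qed

section \<open>Cartan invariants as Moebius sums\<close>

theorem mainTheorem11:
  fixes eg :: "'m::{monoid_mult,finite} set \<Rightarrow> 'm"
    and X Y :: "'m set"
    and PX PY :: "('m \<Rightarrow> 'k::field) set"
  assumes "R_trivial TYPE('m)"
    and "\<forall>Z\<in>Lambda. idem (eg Z) \<and> two_sided (eg Z) = Z"
    and "X \<in> Lambda" and "Y \<in> Lambda"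
    and "proj_cover X PX" and "proj_cover Y PY"
  shows "int (hom_dim PX PY) =
    (\<Sum>Z\<in>{Z\<in>Lambda. Z \<subseteq> X}. int (mcount eg Z Y) * mobius Lambda (\<subseteq>) Z X)"
proof -
  note R = assms(1) and eg = assms(2)
  obtain \<epsilon> where \<epsilon>: "\<epsilon> \<in> PX" "\<And>p. p \<in> PX \<Longrightarrow> conv p \<epsilon> = p"
    "\<And>Z. Z \<in> Lambda \<Longrightarrow> lin_ext (char_S Z) \<epsilon> = (if Z = X then 1 else 0)"
    using proj_cover_idempotent[OF R assms(3,5)] by blast
  obtain \<eta> where \<eta>: "\<eta> \<in> PY" "\<And>p. p \<in> PY \<Longrightarrow> conv p \<eta> = p"
    "\<And>Z. Z \<in> Lambda \<Longrightarrow> lin_ext (char_S Z) \<eta> = (if Z = Y then 1 else 0)"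
    using proj_cover_idempotent[OF R assms(4,6)] by blast
  have PX: "kM_submodule PX" and PY: "kM_submodule PY"
    using assms(5,6) unfolding proj_cover_def by blast+
  have PY_eq: "PY = range (\<lambda>p. conv p \<eta>)"
    using \<eta>(2) kM_submodule_conv[OF PY \<eta>(1)] by (metis (no_types, lifting) image_subset_iff rangeI subsetI subset_antisym)
  obtain \<mu> where \<mu>: "\<And>a. conv a a = a \<Longrightarrow> fs.dim (conv a ` PY)
      = (\<Sum>Z\<in>Lambda. if lin_ext (char_S Z) a \<noteq> 0 then \<mu> Z else 0)"
    using submodule_multiplicities[OF R PY] by blast
  have "hom_dim PX PY = fs.dim (conv \<epsilon> ` PY)"
    by (rule hom_dim_eq[OF PX PY \<epsilon>(1,2)])
  \<comment> \<open>The characters evaluated at \<epsilon> single out X.\<close>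
  also have "\<dots> = (\<Sum>Z\<in>Lambda. if Z = X then \<mu> Z else 0)"
    unfolding \<mu>[OF \<epsilon>(2)[OF \<epsilon>(1)]] by (intro sum.cong) (auto simp: \<epsilon>(3))
  finally have hom: "hom_dim PX PY = \<mu> X" using assms(3) by simp
  \<comment> \<open>The dimension of e_W P_Y is computed twice, from the right by counting elements
    and from the left by multiplicities.\<close>
  have mcount: "mcount eg W Y = (\<Sum>Z\<in>{Z\<in>Lambda. Z \<subseteq> W}. \<mu> Z)" if W: "W \<in> Lambda" for W
  proof -
    let ?d = "delta (eg W) :: 'm \<Rightarrow> 'k"
    let ?U = "{n. eg W * n = n}"
    have e: "idem (eg W)" "two_sided (eg W) = W" using eg W by auto
    have dd: "conv ?d ?d = ?d"
      unfolding conv_delta_eq using e(1) by (auto simp: lmul_def delta_def idem_def)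
    \<comment> \<open>The set \<open>?U\<close> is the right ideal e_W M; this fact and the next
      show that e_W kM consists of the functions supported on it.\<close>
    have supp: "conv ?d p \<in> {p. \<forall>x. x \<notin> ?U \<longrightarrow> p x = 0}" for p
      unfolding conv_delta_eq lmul_def using e(1)
      by (auto simp: idem_def mult.assoc[symmetric] intro!: sum.neutral)
    have fixed: "conv ?d p = p" if p: "\<forall>x. x \<notin> ?U \<longrightarrow> p x = 0" for p
    proof
      fix z
      have "(\<Sum>y\<in>{y. eg W * y = z}. p y) = (\<Sum>y\<in>UNIV. if y = z then p y else 0)"
        using p e(1) by (intro sum.mono_neutral_cong_left) (auto simp: idem_def)
      then show "conv ?d p z = p z" unfolding conv_delta_eq lmul_def by simp
    qed
    have "conv ?d ` PY = (\<lambda>p. conv p \<eta>) ` {p. \<forall>x. x \<notin> ?U \<longrightarrow> p x = 0}"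
    proof (intro equalityI subsetI)
      fix q assume "q \<in> conv ?d ` PY"
      then obtain p where "q = conv (conv ?d p) \<eta>" unfolding PY_eq by (auto simp: conv_assoc)
      then show "q \<in> (\<lambda>p. conv p \<eta>) ` {p. \<forall>x. x \<notin> ?U \<longrightarrow> p x = 0}" using supp by blast
    next
      fix q assume "q \<in> (\<lambda>p. conv p \<eta>) ` {p. \<forall>x. x \<notin> ?U \<longrightarrow> p x = 0}"
      then obtain p where p: "\<forall>x. x \<notin> ?U \<longrightarrow> p x = 0" and q: "q = conv p \<eta>" by blast
      have "q = conv ?d (conv p \<eta>)" unfolding q conv_assoc[symmetric] fixed[OF p] ..
      then show "q \<in> conv ?d ` PY" unfolding PY_eq by blast
    qed
    then have "fs.dim (conv ?d ` PY)
        = card {n\<in>?U. lin_ext (\<lambda>m. if n * m = n then 1 else 0) \<eta> \<noteq> 0}"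
      using dim_right_ideal_idempotent[OF R \<eta>(2)[OF \<eta>(1)], of ?U] by (simp add: mult.assoc[symmetric])
    also have "{n\<in>?U. lin_ext (\<lambda>m. if n * m = n then 1 else 0) \<eta> \<noteq> 0}
        = {n \<in> Ltilde_class (eg Y). eg W * n = n}"
    proof -
      \<comment> \<open>The diagonal entry at \<open>n\<close> is the value at \<eta> of some simple
        character, and only that of Y is nonzero there.\<close>
      have "lin_ext (\<lambda>m. if n * m = n then 1 else 0) \<eta> \<noteq> 0 \<longleftrightarrow> n \<in> Ltilde_class (eg Y)" for n
      proof -
        obtain Z where Z: "Z \<in> Lambda" "(char_S Z :: 'm \<Rightarrow> 'k) = (\<lambda>m. if n * m = n then 1 else 0)"
          using fix_character_eq_char_S[OF R, of n] by blast
        have "lin_ext (\<lambda>m. if n * m = n then 1 else 0) \<eta> \<noteq> 0 \<longleftrightarrow> Z = Y"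
          unfolding Z(2)[symmetric] \<eta>(3)[OF Z(1)] by simp
        also have "\<dots> \<longleftrightarrow> (char_S Y :: 'm \<Rightarrow> 'k) = char_S Z"
          using char_S_inj[OF R assms(4) Z(1)] by blast
        also have "\<dots> \<longleftrightarrow> n \<in> Ltilde_class (eg Y)"
          using Ltilde_class_iff[OF R, of "eg Y" n, where 'k = 'k] eg assms(4) unfolding Z(2) by simp
        finally show ?thesis .
      qed
      then show ?thesis by blast
    qed
    finally have "mcount eg W Y = fs.dim (conv ?d ` PY)" unfolding mcount_def by simp
    \<comment> \<open>The character of Z at e_W is 1 or 0 according to whether Z lies in W.\<close>
    also have "\<dots> = (\<Sum>Z\<in>Lambda. if Z \<subseteq> W then \<mu> Z else 0)"
      unfolding \<mu>[OF dd] lin_ext_delta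
    proof (intro sum.cong refl)
      fix Z :: "'m set" assume "Z \<in> Lambda"
      then have Z: "idem (eg Z)" "two_sided (eg Z) = Z" using eg by auto
      show "(if char_S Z (eg W) \<noteq> (0::'k) then \<mu> Z else 0) = (if Z \<subseteq> W then \<mu> Z else 0)"
        using char_S_eq[OF R Z(1), of "eg W"] two_sided_subset_iff[OF R Z(1) e(1)]
        unfolding Z e by auto
    qed
    finally show ?thesis by (simp add: sum.inter_filter)
  qed
  have "(\<Sum>Z\<in>{Z\<in>Lambda. Z \<subseteq> X}. int (mcount eg Z Y) * mobius Lambda (\<subseteq>) Z X)
      = (\<Sum>Z\<in>{Z\<in>Lambda. Z \<subseteq> X}. (\<Sum>W\<in>{W\<in>Lambda. W \<subseteq> Z}. int (\<mu> W)) * mobius Lambda (\<subseteq>) Z X)"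
    by (intro sum.cong refl) (simp add: mcount)
  also have "\<dots> = int (\<mu> X)"
    by (rule mobius_inversion) (use assms(3) in auto)
  finally show ?thesis using hom by simp
qed

end
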